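(* Let $N\ge 3$, let $m_1,\dots,m_N$ be positive masses, assume that the potential $V$ is attractive or repulsive, and let $\mathbf q=(\mathbf q_1,\dots,\mathbf q_N)\in Q$ be a Dziobek configuration in $\mathbb S^{N-2}$. Then $\mathbf q$ is an equilibrium configuration if and only if there is a nonzero real number $p$ such that $$m_im_jS_{ij}=p\,\Delta_i\Delta_j\qquad\text{for all } i\ne j.$$
   Context: $\mathbb S^{N-2}$ is the unit sphere of $\mathbb R^{N-1}$. For points $\mathbf q_i,\mathbf q_j$ on it, $d_{ij}\in[0,\pi]$ is the geodesic distance, $\cos d_{ij}=\mathbf q_i\cdot \mathbf q_j$. $G:(0,\pi)\to\mathbb R$ is a given smooth function and $Q$ is the set of configurations $\mathbf q=(\mathbf q_1,\dots,\mathbf q_N)\in(\mathbb S^{N-2})^N$ with $d_{ij}\in(0,\pi)$ for all $i\ne j$. The potential is $V(\mathbf q)=\sum_{1\le i<j\le N}m_im_jG(d_{ij})$; it is attractive if $G'>0$ on $(0,\pi)$ and repulsive if $G'<0$ on $(0,\pi)$. A configuration $\mathbf q\in Q$ is an equilibrium configuration if it is a critical point of $V$ on $Q$, i.e. if $$\sum_{j=1,j\ne i}^N\frac{m_im_jG'(d_{ij})}{\sin d_{ij}}\,[\mathbf q_j-\cos d_{ij}\,\mathbf q_i]=0,\qquad i=1,\dots,N.$$ Set $S_{ij}=\frac{G'(d_{ij})}{\sin d_{ij}}$ for $i\neq j$. A configuration of $N$ bodies is a Dziobek configuration if $\operatorname{rank}(\mathbf q_1,\dots,\mathbf q_N)=N-1$.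 Let $X=[\mathbf q_1,\dots,\mathbf q_N]$ be the $(N-1)\times N$ matrix with columns $\mathbf q_i$, let $X_k$ be the square matrix obtained from $X$ by deleting the $k$-th column, and let $\Delta_k=(-1)^{k+1}\det X_k$. *)

theory Defs
  imports "HOL-Analysis.Derivative" "Jordan_Normal_Form.DL_Rank"
begin

unbundle no inner_syntax and no vec_syntax

text \<open>
  Bodies are indexed by \<open>1, \<dots>, N\<close>; a configuration is a function \<open>q :: nat \<Rightarrow> real vec\<close>
  (likewise \<open>m :: nat \<Rightarrow> real\<close> for the masses) of which only the values on \<open>{1..N}\<close> matter.
  Vectors of \<open>\<real>\<^sup>N\<^sup>-\<^sup>1\<close> are elements of \<open>carrier_vec (N - 1)\<close>; their coordinates are indexed from 0.
\<close>

definition unit_sphere :: "nat \<Rightarrow> real vec set" where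
  "unit_sphere n = {x \<in> carrier_vec n. x \<bullet> x = 1}"

definition geod_dist :: "real vec \<Rightarrow> real vec \<Rightarrow> real" where
  "geod_dist x y = arccos (x \<bullet> y)"

definition config_space :: "nat \<Rightarrow> (nat \<Rightarrow> real vec) set" where
  "config_space N = {q. (\<forall>i\<in>{1..N}. q i \<in> unit_sphere (N - 1)) \<and>
     (\<forall>i\<in>{1..N}. \<forall>j\<in>{1..N}. i \<noteq> j \<longrightarrow> geod_dist (q i) (q j) \<in> {0<..<pi})}"

definition potential :: "nat \<Rightarrow> (nat \<Rightarrow> real) \<Rightarrow> (real \<Rightarrow> real) \<Rightarrow> (nat \<Rightarrow> real vec) \<Rightarrow> real" where
  "potential N m G q =
     (\<Sum>i\<in>{1..N}. \<Sum>j\<in>{i<..N}. m i * m j * G (geod_dist (q i) (q j)))"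

text \<open>
  \<open>G\<close> is only meaningful on the open interval \<open>(0, \<pi>)\<close>; since that set is open, \<open>deriv G x\<close> for
  \<open>x\<close> in it does not depend on the values of \<open>G\<close> elsewhere.
\<close>

definition smooth_on_open :: "real set \<Rightarrow> (real \<Rightarrow> real) \<Rightarrow> bool" where
  "smooth_on_open A G \<longleftrightarrow> (\<forall>n. \<forall>x\<in>A. ((deriv ^^ n) G) differentiable (at x))"

definition attractive :: "(real \<Rightarrow> real) \<Rightarrow> bool" where
  "attractive G \<longleftrightarrow> (\<forall>x\<in>{0<..<pi}. deriv G x > 0)"

definition repulsive :: "(real \<Rightarrow> real) \<Rightarrow> bool" where
  "repulsive G \<longleftrightarrow> (\<forall>x\<in>{0<..<pi}. deriv G x < 0)"

definition S_coeff :: "(real \<Rightarrow> real) \<Rightarrow> (nat \<Rightarrow> real vec) \<Rightarrow> nat \<Rightarrow> nat \<Rightarrow> real" where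
  "S_coeff G q i j = deriv G (geod_dist (q i) (q j)) / sin (geod_dist (q i) (q j))"

text \<open>
  The explicit form of the critical point equations; the lemma
  \<open>equilibrium_iff_critical_point\<close> below confirms that they characterise the critical points
  of the potential on the configuration space.
\<close>

definition equilibrium ::
    "nat \<Rightarrow> (nat \<Rightarrow> real) \<Rightarrow> (real \<Rightarrow> real) \<Rightarrow> (nat \<Rightarrow> real vec) \<Rightarrow> bool" where
  "equilibrium N m G q \<longleftrightarrow> q \<in> config_space N \<and>
     (\<forall>i\<in>{1..N}. finsum_vec TYPE(real) (N - 1)
        (\<lambda>j. (m i * m j * deriv G (geod_dist (q i) (q j)) / sin (geod_dist (q i) (q j))) \<cdot>\<^sub>v
             (q j - cos (geod_dist (q i) (q j)) \<cdot>\<^sub>v q i))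
        ({1..N} - {i}) = 0\<^sub>v (N - 1))"

definition config_mat :: "nat \<Rightarrow> (nat \<Rightarrow> real vec) \<Rightarrow> real mat" where
  "config_mat N q = mat_of_cols (N - 1) (map q [1..<N + 1])"

definition config_mat_del :: "nat \<Rightarrow> (nat \<Rightarrow> real vec) \<Rightarrow> nat \<Rightarrow> real mat" where
  "config_mat_del N q k = mat_of_cols (N - 1) (map q (filter (\<lambda>j. j \<noteq> k) [1..<N + 1]))"

definition Delta :: "nat \<Rightarrow> (nat \<Rightarrow> real vec) \<Rightarrow> nat \<Rightarrow> real" where
  "Delta N q k = (-1) ^ (k + 1) * det (config_mat_del N q k)"

definition dziobek :: "nat \<Rightarrow> (nat \<Rightarrow> real vec) \<Rightarrow> bool" where
  "dziobek N q \<longleftrightarrow> vec_space.rank (N - 1) (config_mat N q) = N - 1"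

text \<open>
  Critical points of the potential: its derivative vanishes along every curve in the
  configuration space through the given point that is differentiable there.
\<close>

definition critical_point ::
    "nat \<Rightarrow> (nat \<Rightarrow> real) \<Rightarrow> (real \<Rightarrow> real) \<Rightarrow> (nat \<Rightarrow> real vec) \<Rightarrow> bool" where
  "critical_point N m G q \<longleftrightarrow> q \<in> config_space N \<and>
     (\<forall>c :: real \<Rightarrow> nat \<Rightarrow> real vec.
        (\<forall>i\<in>{1..N}. c 0 i = q i) \<and> (\<forall>\<^sub>F t in nhds 0. c t \<in> config_space N) \<and>
        (\<forall>i\<in>{1..N}. \<forall>k<N - 1. (\<lambda>t. c t i $ k) differentiable (at 0)) \<longrightarrow>
        ((\<lambda>t. potential N m G (c t)) has_real_derivative 0) (at 0))"

lemma unit_sphere_sum: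
  assumes "x \<in> unit_sphere n"
  shows "(\<Sum>k<n. x $ k * x $ k) = 1"
  using assms by (auto simp: unit_sphere_def scalar_prod_def atLeast0LessThan)

lemma scalar_prod_sum:
  assumes "y \<in> carrier_vec n"
  shows "x \<bullet> y = (\<Sum>k<n. x $ k * y $ k)"
  using assms by (auto simp: scalar_prod_def atLeast0LessThan)

lemma unit_sphere_abs_le:
  assumes x: "x \<in> unit_sphere n" and y: "y \<in> unit_sphere n"
  shows "\<bar>x \<bullet> y\<bar> \<le> 1"
proof -
  have yc: "y \<in> carrier_vec n" using y by (simp add: unit_sphere_def)
  have "0 \<le> (\<Sum>k<n. (x $ k + y $ k)\<^sup>2)" "0 \<le> (\<Sum>k<n. (x $ k - y $ k)\<^sup>2)"
    by (simp_all add: sum_nonneg)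
  moreover have "(\<Sum>k<n. (x $ k + y $ k)\<^sup>2) = 2 + 2 * (x \<bullet> y)"
    using unit_sphere_sum[OF x] unit_sphere_sum[OF y]
    by (simp add: scalar_prod_sum[OF yc] sum.distrib power2_eq_square
        sum_distrib_left algebra_simps)
  moreover have "(\<Sum>k<n. (x $ k - y $ k)\<^sup>2) = 2 - 2 * (x \<bullet> y)"
    using unit_sphere_sum[OF x] unit_sphere_sum[OF y]
    by (simp add: scalar_prod_sum[OF yc] sum.distrib sum_subtractf power2_eq_square
        sum_distrib_left algebra_simps)
  ultimately show ?thesis by linarith
qed

lemma geod_dist_iff:
  assumes x: "x \<in> unit_sphere n" and y: "y \<in> unit_sphere n"
  shows "geod_dist x y \<in> {0<..<pi} \<longleftrightarrow> -1 < x \<bullet> y \<and> x \<bullet> y < 1"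
proof
  assume a: "geod_dist x y \<in> {0<..<pi}"
  have "x \<bullet> y \<noteq> 1" "x \<bullet> y \<noteq> -1" using a by (auto simp: geod_dist_def)
  then show "-1 < x \<bullet> y \<and> x \<bullet> y < 1" using unit_sphere_abs_le[OF x y] by linarith
next
  assume "-1 < x \<bullet> y \<and> x \<bullet> y < 1"
  then show "geod_dist x y \<in> {0<..<pi}" using arccos_lt_bounded[of "x \<bullet> y"] by (simp add: geod_dist_def)
qed

lemma geod_dist_sym:
  assumes "x \<in> carrier_vec n" "y \<in> carrier_vec n"
  shows "geod_dist x y = geod_dist y x"
  using assms by (simp add: geod_dist_def comm_scalar_prod)

lemma sum_off_diagonal:
  fixes a :: "nat \<Rightarrow> nat \<Rightarrow> real"
  shows "(\<Sum>i\<in>{1..N}. \<Sum>j\<in>{i<..N}. a i j + a j i) = (\<Sum>i\<in>{1..N}. \<Sum>j\<in>{1..N} - {i}. a i j)"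
proof -
  have "(\<Sum>i\<in>{1..N}. \<Sum>j\<in>{1..N} - {i}. a i j) =
      (\<Sum>i\<in>{1..N}. (\<Sum>j\<in>{i<..N}. a i j) + (\<Sum>j\<in>{1..<i}. a i j))"
  proof (rule sum.cong[OF refl])
    fix i assume "i \<in> {1..N}"
    then have eq: "{1..N} - {i} = {i<..N} \<union> {1..<i}" by auto
    show "(\<Sum>j\<in>{1..N} - {i}. a i j) = (\<Sum>j\<in>{i<..N}. a i j) + (\<Sum>j\<in>{1..<i}. a i j)"
      unfolding eq by (rule sum.union_disjoint) auto
  qed
  also have "\<dots> = (\<Sum>i\<in>{1..N}. \<Sum>j\<in>{i<..N}. a i j) + (\<Sum>i\<in>{1..N}. \<Sum>j\<in>{1..<i}. a i j)"
    by (rule sum.distrib)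
  also have "(\<Sum>i\<in>{1..N}. \<Sum>j\<in>{1..<i}. a i j) = (\<Sum>j\<in>{1..N}. \<Sum>i\<in>{j<..N}. a i j)"
  proof -
    have "(\<Sum>i\<in>{1..N}. \<Sum>j\<in>{1..<i}. a i j) = (\<Sum>(i, j)\<in>(SIGMA i:{1..N}. {1..<i}). a i j)"
      by (rule sum.Sigma) auto
    also have "\<dots> = (\<Sum>(j, i)\<in>(SIGMA j:{1..N}. {j<..N}). a i j)"
      by (rule sum.reindex_bij_witness[where i = prod.swap and j = prod.swap]) auto
    also have "\<dots> = (\<Sum>j\<in>{1..N}. \<Sum>i\<in>{j<..N}. a i j)"
      by (rule sum.Sigma[symmetric]) auto
    finally show ?thesis .
  qed
  finally show ?thesis by (simp add: sum.distrib)
qed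

lemma potential_has_derivative:
  fixes v :: "nat \<Rightarrow> nat \<Rightarrow> real"
  assumes sm: "smooth_on_open {0<..<pi} G" and q: "q \<in> config_space N"
    and c0: "\<And>i. i \<in> {1..N} \<Longrightarrow> c 0 i = q i"
    and cev: "\<forall>\<^sub>F t in nhds (0::real). c t \<in> config_space N"
    and cd: "\<And>i k. i \<in> {1..N} \<Longrightarrow> k < N - 1 \<Longrightarrow> ((\<lambda>t. c t i $ k) has_real_derivative v i k) (at 0)"
  shows "((\<lambda>t. potential N m G (c t)) has_real_derivative
     - (\<Sum>i\<in>{1..N}. \<Sum>k<N - 1. v i k *
          (\<Sum>j\<in>{1..N} - {i}. m i * m j * S_coeff G q i j *
             (q j $ k - cos (geod_dist (q i) (q j)) * q i $ k)))) (at 0)"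
proof -
  note [simp del] = One_nat_def
  have qs: "q i \<in> unit_sphere (N - 1)" if "i \<in> {1..N}" for i
    using q that by (auto simp: config_space_def)
  have qc: "q i \<in> carrier_vec (N - 1)" if "i \<in> {1..N}" for i
    using qs[OF that] by (simp add: unit_sphere_def)
  have gd: "geod_dist (q i) (q j) \<in> {0<..<pi}" if "i \<in> {1..N}" "j \<in> {1..N}" "i \<noteq> j" for i j
    using q that by (auto simp: config_space_def)
  have tang: "(\<Sum>k<N - 1. v i k * q i $ k) = 0" if i: "i \<in> {1..N}" for i
  proof -
    have "((\<lambda>t. \<Sum>k<N - 1. c t i $ k * c t i $ k) has_real_derivative
        (\<Sum>k<N - 1. v i k * c 0 i $ k + v i k * c 0 i $ k)) (at 0)"
      by (intro DERIV_sum DERIV_mult cd i) auto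
    moreover have "((\<lambda>t. \<Sum>k<N - 1. c t i $ k * c t i $ k) has_real_derivative 0) (at 0)"
    proof (subst DERIV_cong_ev[OF refl _ refl])
      show "\<forall>\<^sub>F t in nhds 0. (\<Sum>k<N - 1. c t i $ k * c t i $ k) = 1"
        using cev by eventually_elim (use i in \<open>auto simp: config_space_def unit_sphere_sum\<close>)
      show "((\<lambda>t. 1::real) has_real_derivative 0) (at 0)" by simp
    qed
    ultimately have "(\<Sum>k<N - 1. v i k * c 0 i $ k + v i k * c 0 i $ k) = 0"
      by (rule DERIV_unique)
    then show ?thesis by (simp add: c0[OF i] sum_distrib_left[symmetric])
  qed
  let ?a = "\<lambda>i j. - (m i * m j * S_coeff G q i j * (\<Sum>k<N - 1. v i k * q j $ k))"
  have Ssym: "S_coeff G q i j = S_coeff G q j i" if "i \<in> {1..N}" "j \<in> {1..N}" for i j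
    using geod_dist_sym[OF qc[OF that(1)] qc[OF that(2)]] by (simp add: S_coeff_def)
  have D: "((\<lambda>t. potential N m G (c t)) has_real_derivative
     (\<Sum>i\<in>{1..N}. \<Sum>j\<in>{i<..N}. ?a i j + ?a j i)) (at 0)"
    unfolding potential_def
  proof (intro DERIV_sum)
    fix i j assume i: "i \<in> {1..N}" and "j \<in> {i<..N}"
    then have j: "j \<in> {1..N}" and ij: "i \<noteq> j" by auto
    let ?s = "\<lambda>t. \<Sum>k<N - 1. c t i $ k * c t j $ k"
    let ?s' = "\<Sum>k<N - 1. v i k * c 0 j $ k + v j k * c 0 i $ k"
    let ?d = "geod_dist (q i) (q j)"
    have s0: "?s 0 = q i \<bullet> q j" by (simp add: c0[OF i] c0[OF j] scalar_prod_sum[OF qc[OF j]])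
    have b: "-1 < q i \<bullet> q j" "q i \<bullet> q j < 1"
      using gd[OF i j ij] geod_dist_iff[OF qs[OF i] qs[OF j]] by auto
    have sin: "sin ?d = sqrt (1 - (q i \<bullet> q j)\<^sup>2)"
      using b by (simp add: geod_dist_def sin_arccos)
    have ds: "(?s has_real_derivative ?s') (at 0)"
      by (intro DERIV_sum DERIV_mult cd i j) auto
    have "(arccos has_real_derivative inverse (- sqrt (1 - (?s 0)\<^sup>2))) (at (?s 0))"
      using b unfolding s0 by (rule DERIV_arccos)
    from DERIV_chain2[OF this ds]
    have da: "((\<lambda>t. arccos (?s t)) has_real_derivative inverse (- sin ?d) * ?s') (at 0)"
      by (simp only: s0 sin)
    have "G differentiable (at ?d)"
      using sm[unfolded smooth_on_open_def, rule_format, of ?d 0] gd[OF i j ij] by simp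
    then have "(G has_real_derivative deriv G ?d) (at ?d)"
      by (simp add: DERIV_deriv_iff_real_differentiable)
    then have "(G has_real_derivative deriv G ?d) (at (arccos (?s 0)))"
      by (simp only: s0 geod_dist_def)
    from DERIV_cmult[OF DERIV_chain2[OF this da], of "m i * m j"]
    have dG: "((\<lambda>t. m i * m j * G (arccos (?s t))) has_real_derivative
        m i * m j * (deriv G ?d * (inverse (- sin ?d) * ?s'))) (at 0)" .
    have eq: "m i * m j * (deriv G ?d * (inverse (- sin ?d) * ?s')) = ?a i j + ?a j i"
      unfolding Ssym[OF j i]
      by (simp add: S_coeff_def c0[OF i] c0[OF j] sum.distrib divide_inverse algebra_simps)
    show "((\<lambda>t. m i * m j * G (geod_dist (c t i) (c t j))) has_real_derivative
        ?a i j + ?a j i) (at 0)"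
      unfolding eq[symmetric]
    proof (subst DERIV_cong_ev[OF refl _ refl])
      show "\<forall>\<^sub>F t in nhds 0. m i * m j * G (geod_dist (c t i) (c t j)) =
          m i * m j * G (arccos (?s t))"
        using cev
      proof eventually_elim
        case (elim t)
        then have "c t j \<in> carrier_vec (N - 1)"
          using j by (auto simp: config_space_def unit_sphere_def)
        then show ?case by (simp add: geod_dist_def scalar_prod_sum)
      qed
    qed (rule dG)
  qed
  have "(\<Sum>j\<in>{1..N} - {i}. ?a i j) =
      - (\<Sum>k<N - 1. v i k *
          (\<Sum>j\<in>{1..N} - {i}. m i * m j * S_coeff G q i j *
             (q j $ k - cos (geod_dist (q i) (q j)) * q i $ k)))" if i: "i \<in> {1..N}" for i
  proof -
    have "(\<Sum>k<N - 1. v i k *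
          (\<Sum>j\<in>{1..N} - {i}. m i * m j * S_coeff G q i j *
             (q j $ k - cos (geod_dist (q i) (q j)) * q i $ k))) =
        (\<Sum>j\<in>{1..N} - {i}. \<Sum>k<N - 1. v i k * (m i * m j * S_coeff G q i j *
             (q j $ k - cos (geod_dist (q i) (q j)) * q i $ k)))"
      unfolding sum_distrib_left by (rule sum.swap)
    also have "\<dots> = (\<Sum>j\<in>{1..N} - {i}. - ?a i j)"
    proof (rule sum.cong[OF refl])
      fix j
      have "(\<Sum>k<N - 1. v i k * (m i * m j * S_coeff G q i j *
             (q j $ k - cos (geod_dist (q i) (q j)) * q i $ k))) =
          m i * m j * S_coeff G q i j * ((\<Sum>k<N - 1. v i k * q j $ k) -
             cos (geod_dist (q i) (q j)) * (\<Sum>k<N - 1. v i k * q i $ k))"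
        unfolding sum_distrib_left sum_subtractf[symmetric]
        by (rule sum.cong) (simp_all add: algebra_simps)
      then show "(\<Sum>k<N - 1. v i k * (m i * m j * S_coeff G q i j *
             (q j $ k - cos (geod_dist (q i) (q j)) * q i $ k))) = - ?a i j"
        by (simp add: tang[OF i])
    qed
    finally show ?thesis by (simp add: sum_negf)
  qed
  then show ?thesis using D unfolding sum_off_diagonal by (simp add: sum_negf)
qed

lemma equilibrium_components:
  assumes q: "q \<in> config_space N"
  shows "equilibrium N m G q \<longleftrightarrow> (\<forall>i\<in>{1..N}. \<forall>k<N - 1.
     (\<Sum>j\<in>{1..N} - {i}. m i * m j * S_coeff G q i j *
        (q j $ k - cos (geod_dist (q i) (q j)) * q i $ k)) = 0)"
proof -
  have qc: "q i \<in> carrier_vec (N - 1)" if "i \<in> {1..N}" for i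
    using q that by (auto simp: config_space_def unit_sphere_def)
  let ?f = "\<lambda>i j. (m i * m j * deriv G (geod_dist (q i) (q j)) / sin (geod_dist (q i) (q j))) \<cdot>\<^sub>v
             (q j - cos (geod_dist (q i) (q j)) \<cdot>\<^sub>v q i)"
  have "finsum_vec TYPE(real) (N - 1) (?f i) ({1..N} - {i}) = 0\<^sub>v (N - 1) \<longleftrightarrow>
      (\<forall>k<N - 1. (\<Sum>j\<in>{1..N} - {i}. m i * m j * S_coeff G q i j *
        (q j $ k - cos (geod_dist (q i) (q j)) * q i $ k)) = 0)" if i: "i \<in> {1..N}" for i
  proof -
    have cl: "?f i \<in> {1..N} - {i} \<rightarrow> carrier_vec (N - 1)"
      using qc i by auto
    have dim: "dim_vec (finsum_vec TYPE(real) (N - 1) (?f i) ({1..N} - {i})) = N - 1"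
      using finsum_vec_closed[OF cl] by (rule carrier_vecD)
    have comp: "finsum_vec TYPE(real) (N - 1) (?f i) ({1..N} - {i}) $ k =
        (\<Sum>j\<in>{1..N} - {i}. m i * m j * S_coeff G q i j *
          (q j $ k - cos (geod_dist (q i) (q j)) * q i $ k))" if k: "k < N - 1" for k
      unfolding index_finsum_vec[OF finite_Diff[OF finite_atLeastAtMost] k cl]
    proof (rule sum.cong[OF refl])
      fix j assume "j \<in> {1..N} - {i}"
      then have "dim_vec (q j) = N - 1" "dim_vec (q i) = N - 1"
        using qc[of j] qc[OF i] by auto
      then show "?f i j $ k = m i * m j * S_coeff G q i j *
          (q j $ k - cos (geod_dist (q i) (q j)) * q i $ k)"
        using k by (simp add: S_coeff_def)
    qed
    show ?thesis
      by (subst vec_eq_iff) (simp only: dim comp index_zero_vec simp_thms cong: conj_cong imp_cong)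
  qed
  then show ?thesis unfolding equilibrium_def using q by auto
qed

lemma equilibrium_iff_critical_point:
  assumes sm: "smooth_on_open {0<..<pi} G"
  shows "equilibrium N m G q \<longleftrightarrow> critical_point N m G q"
proof
  assume eq: "equilibrium N m G q"
  then have q: "q \<in> config_space N" by (simp add: equilibrium_def)
  show "critical_point N m G q"
    unfolding critical_point_def
  proof (intro conjI allI impI q)
    fix c :: "real \<Rightarrow> nat \<Rightarrow> real vec"
    assume c: "(\<forall>i\<in>{1..N}. c 0 i = q i) \<and> (\<forall>\<^sub>F t in nhds 0. c t \<in> config_space N) \<and>
        (\<forall>i\<in>{1..N}. \<forall>k<N - 1. (\<lambda>t. c t i $ k) differentiable (at 0))"
    have "((\<lambda>t. c t i $ k) has_real_derivative deriv (\<lambda>t. c t i $ k) 0) (at 0)"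
      if "i \<in> {1..N}" "k < N - 1" for i k
      using c that by (simp add: DERIV_deriv_iff_real_differentiable)
    from potential_has_derivative[OF sm q _ _ this, where m = m] c
    show "((\<lambda>t. potential N m G (c t)) has_real_derivative 0) (at 0)"
      using eq[unfolded equilibrium_components[OF q]] by simp
  qed
next
  assume cp: "critical_point N m G q"
  then have q: "q \<in> config_space N" by (simp add: critical_point_def)
  note [simp del] = One_nat_def
  have qs: "q i \<in> unit_sphere (N - 1)" if "i \<in> {1..N}" for i
    using q that by (auto simp: config_space_def)
  have qc: "q i \<in> carrier_vec (N - 1)" if "i \<in> {1..N}" for i
    using qs[OF that] by (simp add: unit_sphere_def)
  show "equilibrium N m G q"
    unfolding equilibrium_components[OF q]
  proof (rule ballI)
    fix i assume i: "i \<in> {1..N}"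
    define u where "u k = (\<Sum>j\<in>{1..N} - {i}. m i * m j * S_coeff G q i j *
        (q j $ k - cos (geod_dist (q i) (q j)) * q i $ k))" for k
    define U where "U = (\<Sum>k<N - 1. u k * u k)"
    have U0: "U \<ge> 0" by (simp add: U_def sum_nonneg)
    have orth: "(\<Sum>k<N - 1. q i $ k * u k) = 0"
    proof -
      have "(\<Sum>k<N - 1. q i $ k * u k) =
          (\<Sum>j\<in>{1..N} - {i}. \<Sum>k<N - 1. q i $ k * (m i * m j * S_coeff G q i j *
             (q j $ k - cos (geod_dist (q i) (q j)) * q i $ k)))"
        unfolding u_def sum_distrib_left by (rule sum.swap)
      also have "\<dots> = 0"
      proof (rule sum.neutral, rule ballI)
        fix j assume "j \<in> {1..N} - {i}"
        then have j: "j \<in> {1..N}" by simp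
        have "cos (geod_dist (q i) (q j)) = (\<Sum>k<N - 1. q i $ k * q j $ k)"
          using unit_sphere_abs_le[OF qs[OF i] qs[OF j]]
          by (simp add: geod_dist_def abs_le_iff cos_arccos scalar_prod_sum[OF qc[OF j]])
        moreover have "(\<Sum>k<N - 1. q i $ k * (m i * m j * S_coeff G q i j *
             (q j $ k - cos (geod_dist (q i) (q j)) * q i $ k))) =
          m i * m j * S_coeff G q i j * ((\<Sum>k<N - 1. q i $ k * q j $ k) -
             cos (geod_dist (q i) (q j)) * (\<Sum>k<N - 1. q i $ k * q i $ k))"
          unfolding sum_distrib_left sum_subtractf[symmetric]
          by (rule sum.cong) (simp_all add: algebra_simps)
        ultimately show "(\<Sum>k<N - 1. q i $ k * (m i * m j * S_coeff G q i j *
             (q j $ k - cos (geod_dist (q i) (q j)) * q i $ k))) = 0"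
          by (simp add: unit_sphere_sum[OF qs[OF i]])
      qed
      finally show ?thesis .
    qed
    define r where "r t = sqrt (1 + t\<^sup>2 * U)" for t
    have rpos: "r t > 0" for t using U0 by (simp add: r_def add_pos_nonneg)
    define p where "p t = vec (N - 1) (\<lambda>k. (q i $ k + t * u k) / r t)" for t
    define c where "c t = q(i := p t)" for t
    define v where "v j k = (if j = i then u k else 0)" for j k
    have p0: "p 0 = q i" using qc[OF i] by (auto simp: p_def r_def)
    have ps: "p t \<in> unit_sphere (N - 1)" for t
    proof -
      have "(\<Sum>k<N - 1. (q i $ k + t * u k) * (q i $ k + t * u k)) =
          (\<Sum>k<N - 1. q i $ k * q i $ k) + 2 * t * (\<Sum>k<N - 1. q i $ k * u k) + t\<^sup>2 * U"
        unfolding U_def sum_distrib_left sum.distrib[symmetric]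
        by (rule sum.cong) (simp_all add: algebra_simps power2_eq_square)
      also have "\<dots> = r t * r t"
        using U0 by (simp add: orth unit_sphere_sum[OF qs[OF i]] r_def)
      finally have "(\<Sum>k<N - 1. (q i $ k + t * u k) / r t * ((q i $ k + t * u k) / r t)) = 1"
        using rpos[of t] by (simp add: sum_divide_distrib[symmetric])
      then show ?thesis
        by (simp add: unit_sphere_def scalar_prod_def p_def atLeast0LessThan)
    qed
    have dr: "(r has_real_derivative 0) (at 0)"
      unfolding r_def by (auto intro!: derivative_eq_intros)
    have dp: "((\<lambda>t. p t $ k) has_real_derivative u k) (at 0)" if k: "k < N - 1" for k
    proof -
      have "((\<lambda>t. (q i $ k + t * u k) / r t) has_real_derivative u k) (at 0)"
        using rpos[of 0] by (auto intro!: derivative_eq_intros dr simp: r_def)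
      then show ?thesis using k by (simp add: p_def)
    qed
    have cd: "((\<lambda>t. c t j $ k) has_real_derivative v j k) (at 0)"
      if "j \<in> {1..N}" "k < N - 1" for j k
      using dp[OF that(2)] by (auto simp: c_def v_def)
    have ev: "\<forall>\<^sub>F t in nhds 0. geod_dist (p t) (q j) \<in> {0<..<pi} \<and>
        geod_dist (q j) (p t) \<in> {0<..<pi}" if j: "j \<in> {1..N} - {i}" for j
    proof -
      have jN: "j \<in> {1..N}" using j by simp
      let ?s = "\<lambda>t. \<Sum>k<N - 1. p t $ k * q j $ k"
      have "isCont ?s 0"
        using DERIV_isCont[OF dp] by (intro continuous_intros) auto
      then have "(?s \<longlongrightarrow> ?s 0) (nhds 0)"
        by (simp only: isCont_def tendsto_nhds_iff simp_thms)
      then have lim: "(?s \<longlongrightarrow> q i \<bullet> q j) (nhds 0)"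
        by (simp add: p0 scalar_prod_sum[OF qc[OF jN]])
      have "-1 < q i \<bullet> q j" "q i \<bullet> q j < 1"
        using q i j geod_dist_iff[OF qs[OF i] qs[OF jN]] by (auto simp: config_space_def)
      with order_tendstoD[OF lim]
      have "\<forall>\<^sub>F t in nhds 0. -1 < ?s t" "\<forall>\<^sub>F t in nhds 0. ?s t < 1" by auto
      then show ?thesis
      proof eventually_elim
        case (elim t)
        then have "geod_dist (p t) (q j) \<in> {0<..<pi}"
          using geod_dist_iff[OF ps qs[OF jN]] by (simp add: scalar_prod_sum[OF qc[OF jN]])
        moreover have "geod_dist (q j) (p t) = geod_dist (p t) (q j)"
          using qc[OF jN] ps[of t] by (intro geod_dist_sym) (auto simp: unit_sphere_def)
        ultimately show ?case by simp
      qed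
    qed
    have cev: "\<forall>\<^sub>F t in nhds 0. c t \<in> config_space N"
    proof -
      have "\<forall>\<^sub>F t in nhds 0. \<forall>j\<in>{1..N} - {i}. geod_dist (p t) (q j) \<in> {0<..<pi} \<and>
        geod_dist (q j) (p t) \<in> {0<..<pi}"
        using ev by (intro eventually_ball_finite) auto
      then show ?thesis
      proof eventually_elim
        case (elim t)
        then show ?case
          using q ps[of t] by (auto simp: config_space_def c_def)
      qed
    qed
    have c0: "c 0 j = q j" for j by (simp add: c_def p0)
    have "((\<lambda>t. potential N m G (c t)) has_real_derivative
       - (\<Sum>j\<in>{1..N}. \<Sum>k<N - 1. v j k *
          (\<Sum>l\<in>{1..N} - {j}. m j * m l * S_coeff G q j l *
             (q l $ k - cos (geod_dist (q j) (q l)) * q j $ k)))) (at 0)"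
      by (rule potential_has_derivative[OF sm q c0 cev cd])
    moreover have "(\<Sum>j\<in>{1..N}. \<Sum>k<N - 1. v j k *
          (\<Sum>l\<in>{1..N} - {j}. m j * m l * S_coeff G q j l *
             (q l $ k - cos (geod_dist (q j) (q l)) * q j $ k))) = U"
    proof -
      have "(\<Sum>j\<in>{1..N}. \<Sum>k<N - 1. v j k *
          (\<Sum>l\<in>{1..N} - {j}. m j * m l * S_coeff G q j l *
             (q l $ k - cos (geod_dist (q j) (q l)) * q j $ k))) =
          (\<Sum>j\<in>{1..N}. if j = i then U else 0)"
        by (rule sum.cong) (auto simp: v_def U_def u_def)
      then show ?thesis using i by simp
    qed
    moreover have "((\<lambda>t. potential N m G (c t)) has_real_derivative 0) (at 0)"
      using cp c0 cev cd unfolding critical_point_def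
      by (metis real_differentiable_def)
    ultimately have "U = 0" using DERIV_unique by fastforce
    then have "\<forall>k<N - 1. u k = 0"
      unfolding U_def by (subst (asm) sum_nonneg_eq_0_iff) auto
    then show "\<forall>k<N - 1. (\<Sum>j\<in>{1..N} - {i}. m i * m j * S_coeff G q i j *
        (q j $ k - cos (geod_dist (q i) (q j)) * q i $ k)) = 0"
      by (simp add: u_def)
  qed
qed

end

theory Submission
  imports Defs
begin

text \<open>
  Completing \<open>a\<^sub>i\<^sub>j = m\<^sub>i m\<^sub>j S\<^sub>i\<^sub>j\<close> by the diagonal \<open>a\<^sub>i\<^sub>i = - \<Sum>\<^sub>j a\<^sub>i\<^sub>j cos d\<^sub>i\<^sub>j\<close>, the equilibrium equations
  say that every row of \<open>a\<close> lies in the kernel of \<open>X\<close>. Laplace expansion of determinants with a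
  repeated row shows that \<open>\<Delta>\<close> lies in this kernel, and it spans the kernel when the rank of \<open>X\<close>
  is \<open>N - 1\<close>. So \<open>a\<^sub>i\<^sub>j = c\<^sub>i \<Delta>\<^sub>j\<close>, and since \<open>a\<close> is symmetric with nonzero off-diagonal entries,
  \<open>c\<^sub>i / \<Delta>\<^sub>i\<close> does not depend on \<open>i\<close>. Conversely, if \<open>a\<^sub>i\<^sub>j = p \<Delta>\<^sub>i \<Delta>\<^sub>j\<close> off the diagonal, then
  \<open>\<Sum>\<^sub>j \<Delta>\<^sub>j q\<^sub>j = 0\<close> and its inner product with \<open>q\<^sub>i\<close> give the equations.
\<close>

section \<open>Deleting one column of the configuration matrix\<close>

lemma nth_filter_neq:
  assumes "k \<in> {1..N}" "l < N - 1"
  shows "filter (\<lambda>j. j \<noteq> k) [1..<N + 1] ! l = (if l < k - 1 then l + 1 else l + 2)"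
proof -
  have "[1..<N + 1] = [1..<k] @ k # [k + 1..<N + 1]"
    using assms(1) upt_add_eq_append[of 1 k "N + 1 - k"] upt_conv_Cons[of k "N + 1"] by simp
  then have "filter (\<lambda>j. j \<noteq> k) [1..<N + 1] = [1..<k] @ [k + 1..<N + 1]"
    by (simp del: upt_Suc add: filter_id_conv)
  then show ?thesis using assms by (auto simp: nth_append)
qed

lemma length_filter_neq:
  assumes "k \<in> {1..N}"
  shows "length (filter (\<lambda>j. j \<noteq> k) [1..<N + 1]) = N - 1"
proof -
  have "length (filter (\<lambda>j. j \<noteq> k) [1..<N + 1]) = card (set (filter (\<lambda>j. j \<noteq> k) [1..<N + 1]))"
    by (rule distinct_card[symmetric]) simp
  also have "set (filter (\<lambda>j. j \<noteq> k) [1..<N + 1]) = {1..N} - {k}" by auto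
  finally show ?thesis using assms by simp
qed

lemma config_mat_del_carrier:
  assumes "k \<in> {1..N}"
  shows "config_mat_del N q k \<in> carrier_mat (N - 1) (N - 1)"
  using mat_of_cols_carrier(1)[of "N - 1" "map q (filter (\<lambda>j. j \<noteq> k) [1..<N + 1])"]
  unfolding config_mat_del_def length_map length_filter_neq[OF assms] .

section \<open>The kernel of the configuration matrix\<close>

text \<open>A second copy of row \<open>r\<close> put on top of X gives a singular square matrix,
  and the cofactors along that top row are the numbers \<open>Delta N q j\<close>.\<close>

lemma sum_Delta_eq_0:
  assumes r: "r < N - 1"
  shows "(\<Sum>j\<in>{1..N}. Delta N q j * q j $ r) = 0"
proof -
  \<comment> \<open>Row 0 is row \<open>r\<close> of X and every later row \<open>i\<close> is row
    \<open>i - 1\<close> of X. Column \<open>j\<close> belongs to body \<open>j + 1\<close>, so the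
    minor at \<open>(0, j)\<close> comes from X without the column of that body.\<close>
  define M where "M = mat N N (\<lambda>(i, j). q (j + 1) $ (if i = 0 then r else i - 1))"
  have M: "M \<in> carrier_mat N N" by (simp add: M_def)
  have del: "mat_delete M 0 j = config_mat_del N q (j + 1)" if j: "j < N" for j
  proof (rule eq_matI)
    have k: "j + 1 \<in> {1..N}" using j by auto
    note C = config_mat_del_carrier[OF k, of q]
    show "dim_row (mat_delete M 0 j) = dim_row (config_mat_del N q (j + 1))"
      "dim_col (mat_delete M 0 j) = dim_col (config_mat_del N q (j + 1))"
      using C by (auto simp: mat_delete_def M_def)
    fix s l assume "s < dim_row (config_mat_del N q (j + 1))"
      and "l < dim_col (config_mat_del N q (j + 1))"
    then have sl: "s < N - 1" "l < N - 1" using C by auto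
    have "config_mat_del N q (j + 1) $$ (s, l) = q (filter (\<lambda>i. i \<noteq> j + 1) [1..<N + 1] ! l) $ s"
      unfolding config_mat_del_def
      using sl length_filter_neq[OF k] by (subst mat_of_cols_index) (simp_all)
    then show "mat_delete M 0 j $$ (s, l) = config_mat_del N q (j + 1) $$ (s, l)"
      using sl j unfolding nth_filter_neq[OF k sl(2)]
      by (auto simp: mat_delete_def M_def)
  qed
  have "0 = det M"
    by (rule det_identical_rows[OF M, of 0 "r + 1", symmetric])
      (use r in \<open>auto simp: M_def\<close>)
  also have "\<dots> = (\<Sum>j<N. M $$ (0, j) * cofactor M 0 j)"
    by (rule laplace_expansion_row[OF M]) (use r in auto)
  \<comment> \<open>The signs agree: the cofactor has exponent \<open>0 + j\<close>, and
    \<open>Delta\<close> at \<open>j + 1\<close> has exponent \<open>j + 2\<close>.\<close>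
  also have "\<dots> = (\<Sum>j<N. Delta N q (j + 1) * q (j + 1) $ r)"
    by (rule sum.cong) (auto simp: M_def[symmetric] cofactor_def Delta_def del,
      auto simp: M_def)
  also have "\<dots> = (\<Sum>j\<in>{1..N}. Delta N q j * q j $ r)"
    by (rule sum.reindex_bij_witness[where i = "\<lambda>j. j - 1" and j = "\<lambda>j. j + 1"]) auto
  finally show ?thesis by simp
qed

text \<open>Rank \<open>N - 1\<close> supplies \<open>N - 1\<close> independent columns. They leave
  out exactly one body \<open>k\<close>, and X without column \<open>k\<close> is then
  invertible.\<close>

lemma dziobek_Delta_nonzero:
  assumes N: "N \<ge> 1" and d: "dziobek N q"
    and qc: "\<And>i. i \<in> {1..N} \<Longrightarrow> q i \<in> carrier_vec (N - 1)"
  shows "\<exists>k\<in>{1..N}. Delta N q k \<noteq> 0"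
proof -
  interpret vec_space "TYPE(real)" "N - 1" .
  have cols: "set (cols (config_mat N q)) = q ` {1..N}"
    using qc unfolding config_mat_def by (subst cols_mat_of_cols) auto
  have A: "config_mat N q \<in> carrier_mat (N - 1) N"
    using mat_of_cols_carrier(1)[of "N - 1" "map q [1..<N + 1]"]
    by (simp add: config_mat_def del: upt_Suc)
  have "lin_indpt {}"
    by (rule finite_lin_indpt2) auto
  then have "\<exists>S. finite S \<and> maximal S (\<lambda>T. T \<subseteq> set (cols (config_mat N q)) \<and> lin_indpt T) \<and> {} \<subseteq> S"
    by (intro maximal_exists_superset[of "set (cols (config_mat N q))"]) auto
  then obtain S where S: "maximal S (\<lambda>T. T \<subseteq> set (cols (config_mat N q)) \<and> lin_indpt T)"
    by blast
  have "card S = N - 1"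
    using rank_card_indpt[OF A S] d by (simp add: dziobek_def)
  moreover have "S \<subseteq> q ` {1..N}" and ind: "lin_indpt S"
    using S cols by (auto simp: maximal_def)
  \<comment> \<open>\<open>S\<close> is a set of vectors, while columns are deleted by index;
    \<open>J\<close> picks one body for each vector of \<open>S\<close>.\<close>
  then obtain J where J: "J \<subseteq> {1..N}" "inj_on q J" "S = q ` J"
    by (meson subset_image_inj)
  ultimately have "card J = N - 1" by (simp add: card_image)
  then have "card ({1..N} - J) = 1"
    using J(1) N by (subst card_Diff_subset) (auto intro: finite_subset)
  then obtain k where "{1..N} - J = {k}" by (auto simp: card_1_singleton_iff)
  then have k: "k \<in> {1..N}" and Jk: "J = {1..N} - {k}" using J(1) by auto
  let ?js = "filter (\<lambda>j. j \<noteq> k) [1..<N + 1]"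
  have js: "set ?js = J" using Jk by auto
  have c: "cols (config_mat_del N q k) = map q ?js"
    using qc J(1) js unfolding config_mat_del_def
    by (intro cols_mat_of_cols) auto
  have "distinct (map q ?js)" "set (map q ?js) = S"
    using J js by (auto simp: distinct_map)
  then have "rank (config_mat_del N q k) = N - 1"
    using lin_indpt_full_rank[OF config_mat_del_carrier[OF k], of q] ind unfolding c by metis
  then have "det (config_mat_del N q k) \<noteq> 0"
    using det_rank_iff[OF config_mat_del_carrier[OF k]] by simp
  then show ?thesis using k by (auto simp: Delta_def)
qed

text \<open>A relation with coefficient 0 at \<open>k\<close> involves only the columns other than
  the \<open>k\<close>-th, and these form an invertible matrix.\<close>

lemma kernel_vanishing_at:
  assumes k: "k \<in> {1..N}" and D: "Delta N q k \<noteq> 0" and bk: "b k = 0"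
    and b: "\<And>r. r < N - 1 \<Longrightarrow> (\<Sum>j\<in>{1..N}. b j * q j $ r) = 0"
    and i: "i \<in> {1..N}"
  shows "b i = 0"
proof -
  let ?js = "filter (\<lambda>j. j \<noteq> k) [1..<N + 1]" and ?M = "config_mat_del N q k"
  \<comment> \<open>The remaining coefficients, in the order of the columns of
    \<open>?M\<close>.\<close>
  define w where "w = vec (N - 1) (\<lambda>l. b (?js ! l))"
  note M = config_mat_del_carrier[OF k, of q] and len = length_filter_neq[OF k]
  have bij: "bij_betw ((!) ?js) {..<N - 1} ({1..N} - {k})"
    
    unfolding len[symmetric] by (rule bij_betw_nth) auto
  have "?M *\<^sub>v w = 0\<^sub>v (N - 1)"
  proof (rule eq_vecI)
    fix r assume "r < dim_vec (0\<^sub>v (N - 1) :: real vec)"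
    then have r: "r < N - 1" by simp
    have "(?M *\<^sub>v w) $ r = (\<Sum>l<N - 1. ?M $$ (r, l) * b (?js ! l))"
      using r M by (auto simp: scalar_prod_def w_def atLeast0LessThan)
    also have "\<dots> = (\<Sum>l<N - 1. b (?js ! l) * q (?js ! l) $ r)"
    proof (rule sum.cong[OF refl])
      fix l assume "l \<in> {..<N - 1}"
      then show "?M $$ (r, l) * b (?js ! l) = b (?js ! l) * q (?js ! l) $ r"
        unfolding config_mat_del_def using r len
        by (subst mat_of_cols_index) (auto)
    qed
    also have "\<dots> = (\<Sum>j\<in>{1..N} - {k}. b j * q j $ r)"
      by (rule sum.reindex_bij_betw[OF bij])
    also have "\<dots> = (\<Sum>j\<in>{1..N}. b j * q j $ r)"
      using k bk by (simp add: sum.remove[of _ k])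
    finally show "(?M *\<^sub>v w) $ r = 0\<^sub>v (N - 1) $ r" using b[OF r] r by simp
  qed (use M in auto)
  moreover have "det ?M \<noteq> 0" using D by (simp add: Delta_def)
  moreover have "w \<in> carrier_vec (N - 1)" by (simp add: w_def)
  ultimately have w: "w = 0\<^sub>v (N - 1)"
    using det_0_iff_vec_prod_zero[OF M] by blast
  show ?thesis
  proof (cases "i = k")
    case False
    then have "i \<in> (!) ?js ` {..<N - 1}" using i bij by (auto simp: bij_betw_def)
    then obtain l where l: "l < N - 1" "i = ?js ! l" by auto
    then have "w $ l = b i" by (simp add: w_def)
    then show ?thesis using w l by simp
  qed (use bk in simp)
qed

text \<open>Subtracting from \<open>b\<close> the multiple of \<open>Delta\<close> that agrees with
  it at \<open>k\<close> leaves a kernel element vanishing at \<open>k\<close>, hence zero.\<close>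

lemma kernel_spanned_by_Delta:
  assumes k: "k \<in> {1..N}" and D: "Delta N q k \<noteq> 0"
    and b: "\<And>r. r < N - 1 \<Longrightarrow> (\<Sum>j\<in>{1..N}. b j * q j $ r) = 0"
  shows "\<exists>c. \<forall>j\<in>{1..N}. b j = c * Delta N q j"
proof -
  define c where "c = b k / Delta N q k"
  have "b j - c * Delta N q j = 0" if "j \<in> {1..N}" for j
  proof (rule kernel_vanishing_at[where b = "\<lambda>j. b j - c * Delta N q j", OF k D _ _ that])
    show "b k - c * Delta N q k = 0" using D by (simp add: c_def)
    fix r assume r: "r < N - 1"
    have "(\<Sum>j\<in>{1..N}. (b j - c * Delta N q j) * q j $ r) =
        (\<Sum>j\<in>{1..N}. b j * q j $ r) - c * (\<Sum>j\<in>{1..N}. Delta N q j * q j $ r)"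
      by (simp add: sum_subtractf sum_distrib_left algebra_simps)
    then show "(\<Sum>j\<in>{1..N}. (b j - c * Delta N q j) * q j $ r) = 0"
      using b[OF r] sum_Delta_eq_0[OF r] by simp
  qed
  then show ?thesis by auto
qed

text \<open>Symmetry reads \<open>c i * D j = c j * D i\<close>, so the ratio
  \<open>c i / D i\<close> is constant and serves as \<open>p\<close>.\<close>

lemma symmetric_rank_one_off_diagonal:
  fixes a :: "'i \<Rightarrow> 'i \<Rightarrow> 'a::field"
  assumes two: "\<exists>i\<in>I. \<exists>j\<in>I. i \<noteq> j"
    and a: "\<And>i j. i \<in> I \<Longrightarrow> j \<in> I \<Longrightarrow> i \<noteq> j \<Longrightarrow> a i j = c i * D j"
    and sym: "\<And>i j. i \<in> I \<Longrightarrow> j \<in> I \<Longrightarrow> i \<noteq> j \<Longrightarrow> a i j = a j i"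
    and nz: "\<And>i j. i \<in> I \<Longrightarrow> j \<in> I \<Longrightarrow> i \<noteq> j \<Longrightarrow> a i j \<noteq> 0"
  shows "\<exists>p. p \<noteq> 0 \<and> (\<forall>i\<in>I. \<forall>j\<in>I. i \<noteq> j \<longrightarrow> a i j = p * D i * D j)"
proof -
  \<comment> \<open>Each \<open>i\<close> has a partner \<open>j\<close>: the entry
    \<open>a i j\<close> forces \<open>c i\<close> to be nonzero, and \<open>a j i\<close> forces
    \<open>D i\<close> to be.\<close>
  have D: "D i \<noteq> 0 \<and> c i \<noteq> 0" if "i \<in> I" for i
    using two a nz that by (metis mult_zero_left mult_zero_right)
  have "c i / D i = c j / D j" if "i \<in> I" "j \<in> I" for i j
    using a[of i j] a[of j i] sym[of i j] D that by (cases "i = j") (auto simp: field_simps)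
  moreover obtain i0 where "i0 \<in> I" using two by blast
  ultimately have "\<forall>i\<in>I. c i = c i0 / D i0 * D i" using D by (metis nonzero_divide_eq_eq)
  then show ?thesis
    using a D[OF \<open>i0 \<in> I\<close>] by (intro exI[of _ "c i0 / D i0"]) auto
qed

theorem theorem2:
  fixes N :: nat and m :: "nat \<Rightarrow> real" and G :: "real \<Rightarrow> real" and q :: "nat \<Rightarrow> real vec"
  assumes "N \<ge> 3"
    and "\<forall>i\<in>{1..N}. m i > 0"
    and "smooth_on_open {0<..<pi} G"
    and "attractive G \<or> repulsive G"
    and "q \<in> config_space N"
    and "dziobek N q"
  shows "equilibrium N m G q \<longleftrightarrow>
    (\<exists>p::real. p \<noteq> 0 \<and> (\<forall>i\<in>{1..N}. \<forall>j\<in>{1..N}. i \<noteq> j \<longrightarrow>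
       m i * m j * S_coeff G q i j = p * Delta N q i * Delta N q j))"
proof -
  note [simp del] = One_nat_def
  note q = assms(5)
  define a where "a i j = m i * m j * S_coeff G q i j" for i j
  define C where "C i j = cos (geod_dist (q i) (q j))" for i j
  have qs: "q i \<in> unit_sphere (N - 1)" if "i \<in> {1..N}" for i
    using q that by (auto simp: config_space_def)
  have qc: "q i \<in> carrier_vec (N - 1)" if "i \<in> {1..N}" for i
    using qs[OF that] by (simp add: unit_sphere_def)
  have gd: "geod_dist (q i) (q j) \<in> {0<..<pi}" if "i \<in> {1..N}" "j \<in> {1..N}" "i \<noteq> j" for i j
    using q that by (auto simp: config_space_def)
  have C: "C i j = (\<Sum>r<N - 1. q i $ r * q j $ r)" if "i \<in> {1..N}" "j \<in> {1..N}" for i j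
    using unit_sphere_abs_le[OF qs[OF that(1)] qs[OF that(2)]]
    by (simp add: C_def geod_dist_def abs_le_iff cos_arccos scalar_prod_sum[OF qc[OF that(2)]])
  have sym: "a i j = a j i" if "i \<in> {1..N}" "j \<in> {1..N}" for i j
    using geod_dist_sym[OF qc[OF that(1)] qc[OF that(2)]] by (simp add: a_def S_coeff_def)
  \<comment> \<open>The positive masses and the fixed sign of the derivative of \<open>G\<close>
    enter here.\<close>
  have nz: "a i j \<noteq> 0" if "i \<in> {1..N}" "j \<in> {1..N}" "i \<noteq> j" for i j
  proof -
    have "m i > 0" "m j > 0" using assms(2) that by auto
    moreover have "deriv G (geod_dist (q i) (q j)) \<noteq> 0"
      using assms(4) gd[OF that] unfolding attractive_def repulsive_def by fastforce
    moreover have "sin (geod_dist (q i) (q j)) > 0"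
      using gd[OF that] by (intro sin_gt_zero) auto
    ultimately show ?thesis by (simp add: a_def S_coeff_def)
  qed
  have eq: "equilibrium N m G q \<longleftrightarrow> (\<forall>i\<in>{1..N}. \<forall>r<N - 1.
     (\<Sum>j\<in>{1..N} - {i}. a i j * (q j $ r - C i j * q i $ r)) = 0)"
    unfolding equilibrium_components[OF q] a_def C_def ..
  \<comment> \<open>The factor of \<open>q i $ r\<close> is the same for all \<open>r\<close>; its
    negative is the diagonal entry that makes row \<open>i\<close> a kernel vector.\<close>
  have split: "(\<Sum>j\<in>{1..N} - {i}. a i j * (q j $ r - C i j * q i $ r)) =
      (\<Sum>j\<in>{1..N} - {i}. a i j * q j $ r) - (\<Sum>j\<in>{1..N} - {i}. a i j * C i j) * q i $ r" for i r
    by (simp add: sum_subtractf sum_distrib_right right_diff_distrib mult.assoc)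
  show ?thesis
    unfolding a_def[symmetric]
  proof
    assume E: "equilibrium N m G q"
    obtain k where k: "k \<in> {1..N}" "Delta N q k \<noteq> 0"
      using dziobek_Delta_nonzero[OF _ assms(6) qc] assms(1) by auto
    define b where "b i j = (if j = i then - (\<Sum>j\<in>{1..N} - {i}. a i j * C i j) else a i j)" for i j
    have "\<exists>c. \<forall>j\<in>{1..N}. b i j = c * Delta N q j" if i: "i \<in> {1..N}" for i
    proof (rule kernel_spanned_by_Delta[OF k])
      fix r assume r: "r < N - 1"
      have "(\<Sum>j\<in>{1..N} - {i}. b i j * q j $ r) = (\<Sum>j\<in>{1..N} - {i}. a i j * q j $ r)"
        by (rule sum.cong) (auto simp: b_def)
      then have "(\<Sum>j\<in>{1..N}. b i j * q j $ r) =
          (\<Sum>j\<in>{1..N} - {i}. a i j * (q j $ r - C i j * q i $ r))"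
        unfolding split using i by (simp add: sum.remove[of _ i] b_def)
      then show "(\<Sum>j\<in>{1..N}. b i j * q j $ r) = 0" using E r i by (simp add: eq)
    qed
    then obtain c where c: "\<And>i j. i \<in> {1..N} \<Longrightarrow> j \<in> {1..N} \<Longrightarrow> b i j = c i * Delta N q j"
      by metis
    show "\<exists>p. p \<noteq> 0 \<and> (\<forall>i\<in>{1..N}. \<forall>j\<in>{1..N}. i \<noteq> j \<longrightarrow> a i j = p * Delta N q i * Delta N q j)"
    proof (rule symmetric_rank_one_off_diagonal)
      show "\<exists>i\<in>{1..N}. \<exists>j\<in>{1..N}. i \<noteq> j"
        using assms(1) by (intro bexI[of _ 1] bexI[of _ 2]) auto
      show "a i j = c i * Delta N q j" if "i \<in> {1..N}" "j \<in> {1..N}" "i \<noteq> j" for i j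
        using c[OF that(1,2)] that(3) by (simp add: b_def)
    qed (use sym nz in auto)
  next
    assume "\<exists>p. p \<noteq> 0 \<and> (\<forall>i\<in>{1..N}. \<forall>j\<in>{1..N}. i \<noteq> j \<longrightarrow> a i j = p * Delta N q i * Delta N q j)"
    then obtain p where p: "\<And>i j. i \<in> {1..N} \<Longrightarrow> j \<in> {1..N} \<Longrightarrow> i \<noteq> j \<Longrightarrow>
        a i j = p * Delta N q i * Delta N q j" by blast
    show "equilibrium N m G q"
      unfolding eq
    proof (intro ballI allI impI)
      fix i r assume i: "i \<in> {1..N}" and r: "r < N - 1"
      let ?P = "p * Delta N q i * Delta N q i"
      \<comment> \<open>This is the kernel relation for \<open>Delta\<close> with its
        \<open>i\<close>-th term moved to the other side.\<close>
      have vec: "(\<Sum>j\<in>{1..N} - {i}. a i j * q j $ s) = - ?P * q i $ s" if s: "s < N - 1" for s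
      proof -
        have "(\<Sum>j\<in>{1..N} - {i}. a i j * q j $ s) =
            p * Delta N q i * (\<Sum>j\<in>{1..N} - {i}. Delta N q j * q j $ s)"
          unfolding sum_distrib_left using p[OF i] by (intro sum.cong) auto
        also have "(\<Sum>j\<in>{1..N} - {i}. Delta N q j * q j $ s) = - (Delta N q i * q i $ s)"
          using sum_Delta_eq_0[OF s, of q] i by (simp add: sum.remove[of _ i])
        finally show ?thesis by simp
      qed
      \<comment> \<open>Since \<open>C i j\<close> is an inner product, pairing \<open>vec\<close>
        with the unit vector \<open>q i\<close> gives the value \<open>- ?P\<close>, and the two
        terms of \<open>split\<close> cancel.\<close>
      have "(\<Sum>j\<in>{1..N} - {i}. a i j * C i j) =
          (\<Sum>j\<in>{1..N} - {i}. \<Sum>s<N - 1. q i $ s * (a i j * q j $ s))"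
        using C[OF i] by (intro sum.cong) (auto simp: sum_distrib_left mult_ac)
      also have "\<dots> = (\<Sum>s<N - 1. q i $ s * (\<Sum>j\<in>{1..N} - {i}. a i j * q j $ s))"
        unfolding sum_distrib_left by (rule sum.swap)
      also have "\<dots> = (\<Sum>s<N - 1. - ?P * (q i $ s * q i $ s))"
        using vec by (intro sum.cong) auto
      also have "\<dots> = - ?P"
        unfolding sum_distrib_left[symmetric] unit_sphere_sum[OF qs[OF i]] by simp
      finally show "(\<Sum>j\<in>{1..N} - {i}. a i j * (q j $ r - C i j * q i $ r)) = 0"
        unfolding split vec[OF r] by simp
    qed
  qed
qed

end
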